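(* Let $S$ be a set of $k\ge2$ nonempty binary strings such that the Seeker wins the Renyi-Ulam game with lie restriction $r(S)$. Then the shortest string in $S$ has length at most $4k-4$.
   Context: For a set $S$ of nonempty binary strings, $r(S)$ is the set of all finite binary strings that contain no element of $S$ as a contiguous substring. Renyi-Ulam game with lie restriction $R$: the Obscurer picks $x\in\{1,\dots,n\}$; on each turn the Seeker asks whether $x$ lies in a chosen subset and the Obscurer answers yes or no. For a candidate $y$, its lie pattern is the binary string whose $i$-th bit is $1$ iff the $i$-th answer is false for $y$. The Obscurer's answers must keep the lie pattern of her number in $R$ after every answer. The Seeker wins for $n$ if he has an adaptive strategy which after finitely many questions guarantees that at most one $y\in\{1,\dots,n\}$ has its lie pattern in $R$. "The Seeker wins" means he wins for every $n\ge1$. *)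

theory Defs
  imports Main "HOL-Library.Sublist"
begin

text \<open>Binary strings are lists of type \<^typ>\<open>bool list\<close>, with \<^term>\<open>True\<close> for the bit 1.\<close>

definition avoiding :: "bool list set \<Rightarrow> bool list set" where
  "avoiding S = {w. \<forall>s\<in>S. \<not> sublist s w}"

text \<open>
  An adaptive strategy that asks finitely many questions is a finite decision tree:
  \<open>Ask Q t u\<close> asks whether the number lies in \<open>Q\<close>, and continues with \<open>t\<close> after the answer yes
  and with \<open>u\<close> after the answer no. The number of questions may depend on the answers.
  Questions need not be subsets of \<open>{1..n}\<close>, since only membership of elements of \<open>{1..n}\<close> is
  ever used.
\<close>

datatype strategy = Stop | Ask "nat set" strategy strategy

text \<open>
  A transcript lists the questions in the order they were asked, each with its answer
  (\<^term>\<open>True\<close> for yes).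
\<close>

type_synonym transcript = "(nat set \<times> bool) list"

fun transcripts :: "strategy \<Rightarrow> transcript set" where
  "transcripts Stop = {[]}"
| "transcripts (Ask Q t u) =
     {(Q, True) # h | h. h \<in> transcripts t} \<union> {(Q, False) # h | h. h \<in> transcripts u}"

definition lie_pattern :: "nat \<Rightarrow> transcript \<Rightarrow> bool list" where
  "lie_pattern y h = map (\<lambda>(Q, a). a \<noteq> (y \<in> Q)) h"

definition legal :: "bool list set \<Rightarrow> nat \<Rightarrow> transcript \<Rightarrow> bool" where
  "legal R x h \<longleftrightarrow> (\<forall>i\<in>{1..length h}. lie_pattern x (take i h) \<in> R)"

text \<open>
  The condition concerns completed plays only: if the Obscurer reaches a position in which neither
  answer is legal for her number, that play does not count against the Seeker.
\<close>

definition seeker_wins_for :: "bool list set \<Rightarrow> nat \<Rightarrow> bool" where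
  "seeker_wins_for R n \<longleftrightarrow>
     (\<exists>t. \<forall>h\<in>transcripts t. \<forall>x\<in>{1..n}. legal R x h \<longrightarrow>
        card {y\<in>{1..n}. lie_pattern y h \<in> R} \<le> 1)"

definition seeker_wins :: "bool list set \<Rightarrow> bool" where
  "seeker_wins R \<longleftrightarrow> (\<forall>n\<ge>1. seeker_wins_for R n)"

end

theory Submission
  imports Defs
begin

text \<open>
  Two candidates suffice. Against a question separating them or not (the Seeker's choice) the
  Obscurer picks one bit, so their lie patterns \<open>w\<close> and \<open>w'\<close> grow by \<open>b\<close> and \<open>b \<noteq> d\<close>, with \<open>d\<close> chosen
  by the Seeker and \<open>b\<close> by the Obscurer; the Obscurer has to keep both in \<open>R\<close> forever.

  If she dictates \<open>w\<close> at even times and \<open>w'\<close> at odd times, both following an infinite word \<open>u\<close>,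
  then a string \<open>s\<close> can only occur if its even-indexed or its odd-indexed half occurs in \<open>u\<close>. After
  truncation all strings have length \<open>4k - 3\<close>, so there are \<open>2k\<close> halves, of length at least
  \<open>m = 2k - 2\<close>, and each occurs in at most one of a family of pairwise non-conjugate words of
  period \<open>m\<close>. For \<open>k \<ge> 4\<close> there are \<open>m + 3 = 2k + 1\<close> such words, and one of them contains no half.

  For \<open>k = 2\<close> and \<open>k = 3\<close> this count is too small. There the Obscurer has further strategies: other
  schedules of dictated bits, and finite-state strategies avoiding small sets of short blocks. That
  some strategy always works is checked by evaluation; for \<open>k = 3\<close> only those sets of halves
  that meet nine chosen periodic words have to be inspected.
\<close>

section \<open>The game with two candidates\<close>

text \<open>\<open>I\<close> is an invariant of safe pairs of lie patterns. The bit \<open>d\<close>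
  tells whether the question separates the two candidates; the Obscurer knows it when choosing
  \<open>b\<close>.\<close>

definition playable :: "bool list set \<Rightarrow> bool" where
  "playable R \<longleftrightarrow> (\<exists>I. I [] [] \<and>
     (\<forall>p q. I p q \<longrightarrow> p \<in> R \<and> q \<in> R \<and> (\<forall>d. \<exists>b. I (p @ [b]) (q @ [b \<noteq> d]))))"

lemma playableI:
  assumes "I [] []" "\<And>p q. I p q \<Longrightarrow> p \<in> R \<and> q \<in> R"
    and "\<And>p q d. I p q \<Longrightarrow> \<exists>b. I (p @ [b]) (q @ [b \<noteq> d])"
  shows "playable R"
  unfolding playable_def using assms by (intro exI[of _ I]) simp

lemma playable_mono: "playable R \<Longrightarrow> R \<subseteq> R' \<Longrightarrow> playable R'"
  unfolding playable_def by (elim ex_forward) (simp add: subset_iff)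

text \<open>The Obscurer walks down the decision tree and answers so as to stay inside
  \<open>I\<close>. Starting from an arbitrary pair \<open>p\<close>, \<open>q\<close> lets the
  induction pass to subtrees.\<close>

lemma transcript_of_invariant:
  assumes step: "\<And>p q d. I p q \<Longrightarrow> \<exists>b. I (p @ [b]) (q @ [b \<noteq> d])"
    and "I p q"
  shows "\<exists>h\<in>transcripts t. \<forall>i\<le>length h.
    I (p @ lie_pattern x (take i h)) (q @ lie_pattern y (take i h))"
  using \<open>I p q\<close>
proof (induction t arbitrary: p q)
  case Stop
  then show ?case by (simp add: lie_pattern_def)
next
  case (Ask Q t u)
  have "\<exists>b. I (p @ [b]) (q @ [b \<noteq> ((x \<in> Q) \<noteq> (y \<in> Q))])"
    by (rule step[OF Ask.prems])
  then obtain b where b: "I (p @ [b]) (q @ [b \<noteq> ((x \<in> Q) \<noteq> (y \<in> Q))])"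
    by (rule exE)
  \<comment> \<open>The answer that gives \<open>x\<close> the lie bit \<open>b\<close>; the bit of
    \<open>y\<close> is then forced by whether \<open>Q\<close> separates \<open>x\<close> and
    \<open>y\<close>.\<close>
  define a where "a = (b \<noteq> (x \<in> Q))"
  have bits: "(a \<noteq> (x \<in> Q)) = b" "(a \<noteq> (y \<in> Q)) = (b \<noteq> ((x \<in> Q) \<noteq> (y \<in> Q)))"
    by (auto simp: a_def)
  have "\<exists>h\<in>transcripts (if a then t else u). \<forall>i\<le>length h.
      I ((p @ [b]) @ lie_pattern x (take i h))
        ((q @ [b \<noteq> ((x \<in> Q) \<noteq> (y \<in> Q))]) @ lie_pattern y (take i h))"
    using Ask.IH(1)[OF b] Ask.IH(2)[OF b] by (cases a) simp_all
  then obtain h where h: "h \<in> transcripts (if a then t else u)"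
    "\<forall>i\<le>length h. I ((p @ [b]) @ lie_pattern x (take i h))
        ((q @ [b \<noteq> ((x \<in> Q) \<noteq> (y \<in> Q))]) @ lie_pattern y (take i h))" ..
  have "(Q, a) # h \<in> transcripts (Ask Q t u)"
    using h(1) by (cases a) auto
  moreover have "I (p @ lie_pattern x (take i ((Q, a) # h))) (q @ lie_pattern y (take i ((Q, a) # h)))"
    if "i \<le> length ((Q, a) # h)" for i
  proof (cases i)
    case 0
    then show ?thesis using Ask.prems by (simp add: lie_pattern_def)
  next
    case (Suc j)
    have *: "lie_pattern z (take i ((Q, a) # h)) = (a \<noteq> (z \<in> Q)) # lie_pattern z (take j h)" for z
      by (simp add: Suc lie_pattern_def)
    show ?thesis
      unfolding * bits using h(2) that Suc by simp
  qed
  ultimately show ?case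
    by (intro bexI[of _ "(Q, a) # h"] allI impI)
qed

lemma playable_not_seeker_wins:
  assumes "playable R"
  shows "\<not> seeker_wins R"
proof
  assume "seeker_wins R"
  then have "seeker_wins_for R 2"
    by (simp add: seeker_wins_def)
  then obtain t where t: "\<forall>h\<in>transcripts t. \<forall>x\<in>{1..2}. legal R x h \<longrightarrow>
      card {y\<in>{1..2}. lie_pattern y h \<in> R} \<le> 1"
    unfolding seeker_wins_for_def ..
  obtain I where "I [] [] \<and> (\<forall>p q. I p q \<longrightarrow>
      p \<in> R \<and> q \<in> R \<and> (\<forall>d. \<exists>b. I (p @ [b]) (q @ [b \<noteq> d])))"
    using assms unfolding playable_def ..
  then have I: "I [] []" "\<And>p q. I p q \<Longrightarrow> p \<in> R \<and> q \<in> R"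
    "\<And>p q d. I p q \<Longrightarrow> \<exists>b. I (p @ [b]) (q @ [b \<noteq> d])"
    by simp_all
  obtain h where h: "h \<in> transcripts t"
    "\<forall>i\<le>length h. I (lie_pattern 1 (take i h)) (lie_pattern 2 (take i h))"
    using transcript_of_invariant[where I = I and p = "[]" and q = "[]" and t = t and x = 1 and y = 2, OF I(3) I(1)]
    by auto
  have "legal R 1 h"
    using h(2) I(2) unfolding legal_def by (metis atLeastAtMost_iff)
  moreover have "{y\<in>{1..2}. lie_pattern y h \<in> R} = {1, 2}"
  proof -
    have "lie_pattern 1 h \<in> R" "lie_pattern 2 h \<in> R"
      using I(2)[of "lie_pattern 1 h" "lie_pattern 2 h"] h(2)[rule_format, of "length h"] by simp_all
    moreover have "{1..2::nat} = {1, 2}" by auto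
    ultimately show ?thesis by auto
  qed
  ultimately show False
    using t[rule_format, of h 1] h(1) by simp
qed

definition fits :: "(nat \<Rightarrow> bool) \<Rightarrow> (nat \<Rightarrow> bool) \<Rightarrow> bool list \<Rightarrow> bool" where
  "fits c v s \<longleftrightarrow> (\<exists>j. \<forall>i<length s. c (j + i) \<longrightarrow> s ! i = v (j + i))"

text \<open>One bit per turn is the Obscurer's to fix: the first pattern follows \<open>v\<close>
  where \<open>c\<close> holds, the second where it fails.\<close>

lemma playable_control:
  assumes "\<And>s. s \<in> S \<Longrightarrow> \<not> fits c v s" "\<And>s. s \<in> S \<Longrightarrow> \<not> fits (\<lambda>i. \<not> c i) v s"
  shows "playable (avoiding S)"
proof -
  define ok where "ok = (\<lambda>c p. \<forall>i<length p. c i \<longrightarrow> p ! i = v i)"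
  have avoid: "p \<in> avoiding S" if "ok c' p" "\<And>s. s \<in> S \<Longrightarrow> \<not> fits c' v s" for c' p
  proof (rule ccontr)
    assume "p \<notin> avoiding S"
    then obtain s a b where s: "s \<in> S" "p = a @ s @ b"
      by (auto simp: avoiding_def sublist_def)
    have "s ! i = v (length a + i)" if "i < length s" "c' (length a + i)" for i
      using \<open>ok c' p\<close> that by (auto simp: ok_def s(2) nth_append dest!: spec[of _ "length a + i"])
    then show False
      using that(2) s(1) unfolding fits_def by blast
  qed
  have snoc: "ok c' (p @ [b]) \<longleftrightarrow> ok c' p \<and> (c' (length p) \<longrightarrow> b = v (length p))" for c' p b
    by (auto simp: ok_def nth_append less_Suc_eq)
  show ?thesis
  proof (rule playableI[where I = "\<lambda>p q. length p = length q \<and> ok c p \<and> ok (\<lambda>i. \<not> c i) q"])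
    show "length [] = length [] \<and> ok c [] \<and> ok (\<lambda>i. \<not> c i) []"
      by (simp add: ok_def)
    show "p \<in> avoiding S \<and> q \<in> avoiding S"
      if "length p = length q \<and> ok c p \<and> ok (\<lambda>i. \<not> c i) q" for p q
      using that avoid assms by blast
    show "\<exists>b. length (p @ [b]) = length (q @ [b \<noteq> d]) \<and> ok c (p @ [b]) \<and> ok (\<lambda>i. \<not> c i) (q @ [b \<noteq> d])"
      if "length p = length q \<and> ok c p \<and> ok (\<lambda>i. \<not> c i) q" for p q d
    proof -
      have "b = v (length p) \<Longrightarrow> c (length p) \<Longrightarrow> ?thesis" for b
        using that by (intro exI[of _ b]) (simp add: snoc)
      \<comment> \<open>Flipping by \<open>d\<close> a second time gives the second pattern exactly
        the dictated bit.\<close>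
      moreover have "b = (v (length p) \<noteq> d) \<Longrightarrow> \<not> c (length p) \<Longrightarrow> ?thesis" for b
        using that by (intro exI[of _ b]) (auto simp: snoc)
      ultimately show ?thesis by blast
    qed
  qed
qed

section \<open>Dictating every other bit\<close>

fun evens odds :: "'a list \<Rightarrow> 'a list" where
  "evens [] = []"
| "evens (x # xs) = x # odds xs"
| "odds [] = []"
| "odds (x # xs) = evens xs"

fun weave :: "'a list \<Rightarrow> 'a list \<Rightarrow> 'a list" where
  "weave (x # xs) (y # ys) = x # y # weave xs ys"
| "weave [] ys = ys"
| "weave xs [] = xs"

lemma weave_evens_odds: "weave (evens xs) (odds xs) = xs"
  by (induction xs rule: induct_list012) auto

lemma length_evens: "length (evens xs) = (length xs + 1) div 2"
  and length_odds: "length (odds xs) = length xs div 2"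
  by (induction xs and xs rule: evens_odds.induct) auto

lemma nth_evens: "i < length (evens xs) \<Longrightarrow> evens xs ! i = xs ! (2 * i)"
  and nth_odds: "i < length (odds xs) \<Longrightarrow> odds xs ! i = xs ! (2 * i + 1)"
  by (induction xs and xs arbitrary: i and i rule: evens_odds.induct)
    (auto simp: nth_Cons split: nat.splits)

definition occurs :: "(nat \<Rightarrow> 'a) \<Rightarrow> 'a list \<Rightarrow> bool" where
  "occurs u x \<longleftrightarrow> (\<exists>j. \<forall>i<length x. x ! i = u (j + i))"

text \<open>The dictated times in a placement of \<open>s\<close> are either its even or its odd
  indices, and along them \<open>i div 2\<close> grows by one each time.\<close>

lemma fits_parity_imp_occurs:
  assumes "fits (\<lambda>i. even i = e) (\<lambda>i. u (i div 2)) s"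
  shows "occurs u (evens s) \<or> occurs u (odds s)"
proof -
  obtain j where j: "\<And>i. i < length s \<Longrightarrow> even (j + i) = e \<Longrightarrow> s ! i = u ((j + i) div 2)"
    using assms by (auto simp: fits_def)
  show ?thesis
  proof (cases "even j = e")
    case True
    have "evens s ! i = u (j div 2 + i)" if "i < length (evens s)" for i
      using j[of "2 * i"] that True by (simp add: nth_evens length_evens add.commute)
    then show ?thesis unfolding occurs_def by blast
  next
    case False
    \<comment> \<open>The first dictated bit stands at time \<open>j + 1\<close>, hence this offset
      in \<open>u\<close>.\<close>
    have "odds s ! i = u ((j + 1) div 2 + i)" if "i < length (odds s)" for i
    proof -
      have "(j + (2 * i + 1)) div 2 = (j + 1) div 2 + i" by simp
      then show ?thesis
        using j[of "2 * i + 1"] that False by (auto simp: nth_odds length_odds)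
    qed
    then show ?thesis unfolding occurs_def by blast
  qed
qed

lemma playable_half_control:
  assumes "\<And>s. s \<in> S \<Longrightarrow> \<not> occurs u (evens s)" "\<And>s. s \<in> S \<Longrightarrow> \<not> occurs u (odds s)"
  shows "playable (avoiding S)"
  using playable_control[of S "\<lambda>i. even i = True" "\<lambda>i. u (i div 2)"]
    fits_parity_imp_occurs[of True u] fits_parity_imp_occurs[of False u] assms by fastforce

section \<open>Avoiding blocks\<close>

definition contains_any :: "'a list list \<Rightarrow> 'a list \<Rightarrow> bool" where
  "contains_any F s \<longleftrightarrow> list_ex (\<lambda>f. sublist f s) F"

text \<open>A new occurrence must end in the new bit, and \<open>x @ [b]\<close> is long enough to
  show all of it.\<close>

lemma contains_any_snoc:
  assumes "suffix x w" "\<forall>f\<in>set F. length f \<le> Suc (length x)"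
    and "\<not> contains_any F w" "\<not> contains_any F (x @ [b])"
  shows "\<not> contains_any F (w @ [b])"
proof
  assume "contains_any F (w @ [b])"
  then obtain f where f: "f \<in> set F" "sublist f (w @ [b])"
    by (auto simp: contains_any_def list_ex_iff)
  then have "suffix f (w @ [b])"
    using assms(3) by (auto simp: contains_any_def list_ex_iff sublist_snoc)
  moreover have "suffix (x @ [b]) (w @ [b])"
    using assms(1) by (simp add: suffix_def)
  ultimately have "suffix f (x @ [b])"
    using assms(2) f(1) by (metis length_append_singleton suffix_length_suffix)
  then show False
    using f(1) assms(4) by (auto simp: contains_any_def list_ex_iff)
qed

text \<open>\<open>W\<close> is the state set of a finite automaton for the Obscurer;
  \<open>tl\<close> slides the windows of recent bits.\<close>

definition closed_under_play :: "bool list list \<Rightarrow> (bool list \<times> bool list) list \<Rightarrow> bool" where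
  "closed_under_play F W \<longleftrightarrow> list_all (\<lambda>(x, y).
     list_all (\<lambda>d. list_ex (\<lambda>b.
       \<not> contains_any F (x @ [b]) \<and> \<not> contains_any F (y @ [b \<noteq> d]) \<and>
       (tl (x @ [b]), tl (y @ [b \<noteq> d])) \<in> set W) [False, True]) [False, True]) W"

text \<open>\<open>x0\<close> and \<open>y0\<close> are a fictitious past that fills the windows
  before the first question. A pattern avoids \<open>F\<close> if its prolongation does.\<close>

lemma playable_blocks:
  assumes closed: "closed_under_play F W"
    and len: "list_all (\<lambda>(x, y). list_all (\<lambda>f. length f \<le> Suc (length x) \<and> length f \<le> Suc (length y)) F) W"
    and start: "(x0, y0) \<in> set W" "\<not> contains_any F x0" "\<not> contains_any F y0"
  shows "playable {w. \<not> contains_any F w}"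
proof (rule playableI[where I = "\<lambda>p q. \<exists>(x, y)\<in>set W. suffix x (x0 @ p) \<and> suffix y (y0 @ q) \<and>
      \<not> contains_any F (x0 @ p) \<and> \<not> contains_any F (y0 @ q)"], goal_cases)
  case 1
  then show ?case using start by force
next
  case (2 p q)
  moreover have "contains_any F (w @ p)" if "contains_any F p" for w p
    using that by (auto simp: contains_any_def list_ex_iff sublist_append)
  ultimately show ?case by auto
next
  case (3 p q d)
  then obtain x y where xy: "(x, y) \<in> set W" "suffix x (x0 @ p)" "suffix y (y0 @ q)"
      "\<not> contains_any F (x0 @ p)" "\<not> contains_any F (y0 @ q)"
    by blast
  have "\<exists>b. \<not> contains_any F (x @ [b]) \<and> \<not> contains_any F (y @ [b \<noteq> d]) \<and>
       (tl (x @ [b]), tl (y @ [b \<noteq> d])) \<in> set W"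
    using closed xy(1) unfolding closed_under_play_def list_all_iff list_ex_iff
    by (cases d; fastforce)
  then obtain b where b: "\<not> contains_any F (x @ [b])" "\<not> contains_any F (y @ [b \<noteq> d])"
       "(tl (x @ [b]), tl (y @ [b \<noteq> d])) \<in> set W"
    by blast
  have len': "\<forall>f\<in>set F. length f \<le> Suc (length x)" "\<forall>f\<in>set F. length f \<le> Suc (length y)"
    using len xy(1) unfolding list_all_iff by auto
  have tl_suffix: "suffix (tl (z @ [c])) (w @ [c])" if "suffix z w" for z w :: "bool list" and c
  proof -
    have "suffix (tl (z @ [c])) (z @ [c])" by (rule suffix_tl)
    moreover have "suffix (z @ [c]) (w @ [c])" using that by (simp add: suffix_def)
    ultimately show ?thesis by (rule suffix_order.trans)
  qed
  have "suffix (tl (x @ [b])) (x0 @ p @ [b])" "suffix (tl (y @ [b \<noteq> d])) (y0 @ q @ [b \<noteq> d])"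
    using tl_suffix[OF xy(2)] tl_suffix[OF xy(3)] by simp_all
  moreover have "\<not> contains_any F (x0 @ p @ [b])" "\<not> contains_any F (y0 @ q @ [b \<noteq> d])"
    using contains_any_snoc[OF xy(2) len'(1) xy(4) b(1)] contains_any_snoc[OF xy(3) len'(2) xy(5) b(2)]
    by simp_all
  ultimately show ?case
    using b(3) by blast
qed

text \<open>Turns Obscurer strategies into tests on single strings: it suffices to find one such
  \<open>P\<close> that holds on all of \<open>S\<close>.\<close>

definition defeats :: "(bool list \<Rightarrow> bool) \<Rightarrow> bool" where
  "defeats P \<longleftrightarrow> (\<forall>S. (\<forall>s\<in>S. P s) \<longrightarrow> playable (avoiding S))"

lemma defeats_contains_any:
  assumes "playable {w. \<not> contains_any F w}"
  shows "defeats (contains_any F)"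
proof -
  have "{w. \<not> contains_any F w} \<subseteq> avoiding S" if S: "\<forall>s\<in>S. contains_any F s" for S
  proof
    fix w assume w: "w \<in> {w. \<not> contains_any F w}"
    have "\<not> sublist s w" if "s \<in> S" for s
    proof
      assume "sublist s w"
      moreover obtain f where f: "f \<in> set F" "sublist f s"
        using S \<open>s \<in> S\<close> by (auto simp: contains_any_def list_ex_iff)
      ultimately have "sublist f w"
        by (blast intro: sublist_order.order.trans)
      then show False
        using w f(1) by (auto simp: contains_any_def list_ex_iff)
    qed
    then show "w \<in> avoiding S" by (simp add: avoiding_def)
  qed
  then show ?thesis
    using playable_mono[OF assms] unfolding defeats_def by simp
qed

text \<open>
  An entry \<open>(c, v)\<close> of the period \<open>P\<close> dictates the bit \<open>v\<close> to the first lie pattern if \<open>c\<close>, and to the second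
  one otherwise.
\<close>

definition misfits :: "(bool \<times> bool) list \<Rightarrow> bool list \<Rightarrow> bool" where
  "misfits P s \<longleftrightarrow> list_all (\<lambda>j. list_all (\<lambda>e.
     list_ex (\<lambda>i. case P ! ((j + i) mod length P) of (c, v) \<Rightarrow> c = e \<and> s ! i \<noteq> v) [0..<length s])
     [False, True]) [0..<length P]"

text \<open>Whether a placement fits depends only on its offset modulo the period, so finitely many
  offsets decide; \<open>e\<close> selects the lie pattern.\<close>

lemma defeats_misfits:
  assumes "P \<noteq> []"
  shows "defeats (misfits P)"
  unfolding defeats_def
proof (intro allI impI)
  fix S assume S: "\<forall>s\<in>S. misfits P s"
  have *: "\<not> fits (\<lambda>i. fst (P ! (i mod length P)) = e) (\<lambda>i. snd (P ! (i mod length P))) s"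
    if "s \<in> S" for s e
  proof
    assume "fits (\<lambda>i. fst (P ! (i mod length P)) = e) (\<lambda>i. snd (P ! (i mod length P))) s"
    then obtain j where j: "\<And>i. i < length s \<Longrightarrow> fst (P ! ((j + i) mod length P)) = e \<Longrightarrow>
        s ! i = snd (P ! ((j + i) mod length P))"
      unfolding fits_def by blast
    have "\<exists>i<length s. fst (P ! ((j mod length P + i) mod length P)) = e \<and>
        s ! i \<noteq> snd (P ! ((j mod length P + i) mod length P))"
    proof -
      have "j mod length P \<in> set [0..<length P]" "e \<in> set [False, True]"
        using assms by auto
      then have "list_ex (\<lambda>i. case P ! ((j mod length P + i) mod length P) of
          (c, v) \<Rightarrow> c = e \<and> s ! i \<noteq> v) [0..<length s]"
        using S that unfolding misfits_def list_all_iff by blast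
      then show ?thesis
        by (auto simp: list_ex_iff case_prod_beta)
    qed
    then show False
      using j by (auto simp: mod_add_left_eq)
  qed
  show "playable (avoiding S)"
    using playable_control[of S "\<lambda>i. fst (P ! (i mod length P)) = True" "\<lambda>i. snd (P ! (i mod length P))"]
      *[where e = True] *[where e = False] by simp
qed

section \<open>Two or three strings\<close>

definition bits :: "string \<Rightarrow> bool list" where
  "bits = map (\<lambda>c. c = CHR ''1'')"

definition states :: "(string list \<times> string list) list \<Rightarrow> (bool list \<times> bool list) list" where
  "states W = concat (map (\<lambda>(xs, ys). List.product (map bits xs) (map bits ys)) W)"

text \<open>
  The block lists were found by computer search. The \<open>i\<close>-th list of windows consists of the pairs of
  recent bits of the two lie patterns from which the Obscurer can avoid the \<open>i\<close>-th list of blocks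
  forever; it happens to be a union of few rectangles.
\<close>

definition "blocks1 = map bits [''000'', ''111'', ''00100'', ''11011'']"
definition "blocks2 = map bits [''0110'', ''1001'', ''0101'', ''1010'']"
definition "blocks3 = map bits [''101'', ''111'', ''01001'']"
definition "blocks4 = map bits [''010'', ''000'', ''10110'']"

definition "windows1 = states
  [([''0010'', ''0011'', ''0100'', ''1011'', ''1100'', ''1101''], [''0101'', ''0110'', ''1001'', ''1010'']),
   ([''0101'', ''1010''],
    [''0010'', ''0011'', ''0100'', ''0101'', ''0110'', ''1001'', ''1010'', ''1011'', ''1100'', ''1101'']),
   ([''0110'', ''1001''],
    [''0010'', ''0011'', ''0100'', ''0101'', ''1010'', ''1011'', ''1100'', ''1101''])]"

definition "windows2 = states
  [([''000'', ''111''], [''000'', ''001'', ''010'', ''011'', ''100'', ''101'', ''110'', ''111'']),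
   ([''001'', ''110''], [''000'', ''011'', ''100'', ''111'']),
   ([''010'', ''101''], [''000'', ''111'']),
   ([''011'', ''100''], [''000'', ''001'', ''110'', ''111''])]"

definition "windows3 = states
  [([''0000'', ''1000'', ''1100''],
    [''0000'', ''0001'', ''0010'', ''0011'', ''0100'', ''0110'', ''1000'', ''1001'', ''1100'']),
   ([''0001'', ''1001''], [''0000'', ''0100'', ''0110'', ''1000'', ''1100'']),
   ([''0010'', ''0011''], [''0000'', ''1000'', ''1100'']),
   ([''0100'', ''0110''], [''0000'', ''0001'', ''1000'', ''1001'', ''1100''])]"

text \<open>The bitwise complement of \<open>windows3\<close>, as \<open>blocks4\<close> is of
  \<open>blocks3\<close>.\<close>

definition "windows4 = states
  [([''1111'', ''0111'', ''0011''],
    [''1111'', ''1110'', ''1101'', ''1100'', ''1011'', ''1001'', ''0111'', ''0110'', ''0011'']),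
   ([''1110'', ''0110''], [''1111'', ''1011'', ''1001'', ''0111'', ''0011'']),
   ([''1101'', ''1100''], [''1111'', ''0111'', ''0011'']),
   ([''1011'', ''1001''], [''1111'', ''1110'', ''0111'', ''0110'', ''0011''])]"

lemma windows_start:
  "(bits ''0101'', bits ''0101'') \<in> set windows1" "(bits ''000'', bits ''000'') \<in> set windows2"
  "(bits ''0000'', bits ''0000'') \<in> set windows3" "(bits ''1111'', bits ''1111'') \<in> set windows4"
  by code_simp+

lemma defeats_blocks1: "defeats (contains_any blocks1)"
  by (rule defeats_contains_any, rule playable_blocks[OF _ _ windows_start(1)]) code_simp+

lemma defeats_blocks2: "defeats (contains_any blocks2)"
  by (rule defeats_contains_any, rule playable_blocks[OF _ _ windows_start(2)]) code_simp+

lemma defeats_blocks3: "defeats (contains_any blocks3)"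
  by (rule defeats_contains_any, rule playable_blocks[OF _ _ windows_start(3)]) code_simp+

lemma defeats_blocks4: "defeats (contains_any blocks4)"
  by (rule defeats_contains_any, rule playable_blocks[OF _ _ windows_start(4)]) code_simp+

section \<open>Exhaustive checks for strings of length 5 and 9\<close>

definition "pattern c v = zip (bits c) (bits v)"

definition covers :: "('a \<Rightarrow> bool) list \<Rightarrow> 'a list \<Rightarrow> bool" where
  "covers Ps xs \<longleftrightarrow> list_all (\<lambda>x. list_ex (\<lambda>P. P x) Ps) xs"

definition covers_pairs :: "('a \<Rightarrow> bool) list \<Rightarrow> 'a list \<Rightarrow> bool" where
  "covers_pairs Ps xs \<longleftrightarrow> list_all (\<lambda>x. covers (filter (\<lambda>P. P x) Ps) xs) xs"

text \<open>The lists of even and odd halves do not tell which halves belong together, so all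
  injective matchings are tried. The value \<open>False\<close> for other sizes makes a successful
  search certify that three halves of each kind are forced.\<close>

definition covers_weaves :: "('a list \<Rightarrow> bool) list \<Rightarrow> 'a list list \<Rightarrow> 'a list list \<Rightarrow> bool" where
  "covers_weaves Ps A B \<longleftrightarrow> (case A of [a, a', a''] \<Rightarrow> if length B = 3 then
     list_all (\<lambda>b. let Qs = filter (\<lambda>P. P (weave a b)) Ps in list_all (\<lambda>b'.
       let Rs = filter (\<lambda>P. P (weave a' b')) Qs in list_all (\<lambda>b''.
         if distinct [b, b', b''] then list_ex (\<lambda>P. P (weave a'' b'')) Rs else True) B) B) B else False | _ \<Rightarrow> False)"

definition factors :: "nat \<Rightarrow> 'a list \<Rightarrow> 'a list list" where
  "factors n v = map (\<lambda>j. map (\<lambda>i. v ! ((j + i) mod length v)) [0..<n]) [0..<length v]"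

definition meets :: "'a list \<Rightarrow> 'a list \<Rightarrow> bool" where
  "meets xs ys = list_ex (\<lambda>x. x \<in> set ys) xs"

text \<open>
  Searches for all ways to pick at most \<open>n\<close> strings each for \<open>A\<close> and \<open>B\<close> such that each pair of lists in
  the input is met by \<open>A\<close> in the first or by \<open>B\<close> in the second list, and checks \<open>P\<close> on each result.
\<close>

primrec check_hitting :: "('a list \<Rightarrow> 'b list \<Rightarrow> bool) \<Rightarrow> nat \<Rightarrow> ('a list \<times> 'b list) list \<Rightarrow> 'a list \<Rightarrow> 'b list \<Rightarrow> bool" where
  "check_hitting P n [] A B \<longleftrightarrow> P A B"
| "check_hitting P n (w # ws) A B \<longleftrightarrow>
     (if meets A (fst w) \<or> meets B (snd w) then check_hitting P n ws A B
      else if if length A < n then list_all (\<lambda>a. check_hitting P n ws (a # A) B) (fst w) else True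
      then if length B < n then list_all (\<lambda>b. check_hitting P n ws A (b # B)) (snd w) else True
      else False)"

text \<open>Here 5 is \<open>4 * k - 3\<close> for \<open>k = 2\<close>. Pairs of equal strings are
  included, which serves one-element sets.\<close>

lemma covers_pairs_5:
  "covers_pairs [contains_any blocks1, contains_any blocks2, contains_any blocks3, contains_any blocks4,
     misfits (pattern ''10'' ''00''), misfits (pattern ''10'' ''11'')] (List.n_lists 5 [False, True])"
  by code_simp

text \<open>Strings of length \<open>4 * k - 3 = 9\<close> for \<open>k = 3\<close> have halves of
  lengths 5 and 4, hence the two factor lengths.\<close>

lemma check_hitting_9:
  "check_hitting (covers_weaves [contains_any blocks1, contains_any blocks3, contains_any blocks4, contains_any blocks2,
       misfits (pattern ''11001100'' ''01011010'')]) 3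
     (map (\<lambda>v. (factors 5 v, factors 4 v)) (map bits
       [''0'', ''1'', ''01'', ''011'', ''001'', ''0111'', ''0001'', ''00011'', ''00111''])) [] []"
  by code_simp

section \<open>From the checks to playability\<close>

lemma meets_iff: "meets xs ys \<longleftrightarrow> set xs \<inter> set ys \<noteq> {}"
  by (auto simp: meets_def list_ex_iff)

lemma length_less_card:
  assumes "distinct A" "set A \<subseteq> X" "finite X" "card X \<le> n" "a \<in> X" "a \<notin> set A"
  shows "length A < n"
proof -
  have "set A \<subset> X" using assms by blast
  then have "card (set A) < card X" using assms(3) by (rule psubset_card_mono[rotated])
  then show ?thesis using assms(1,4) by (simp add: distinct_card)
qed

text \<open>Follow a branch whose picks all lie in \<open>X\<close> and \<open>Y\<close>. Each pick
  is new, so by the cardinality bounds the limit \<open>n\<close> never cuts this branch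
  off.\<close>

lemma check_hitting_sound:
  assumes "check_hitting P n ws A B" "distinct A" "distinct B" "set A \<subseteq> X" "set B \<subseteq> Y"
    and "finite X" "finite Y" "card X \<le> n" "card Y \<le> n"
    and "\<And>w. w \<in> set ws \<Longrightarrow> X \<inter> set (fst w) \<noteq> {} \<or> Y \<inter> set (snd w) \<noteq> {}"
  shows "\<exists>A B. P A B \<and> distinct A \<and> distinct B \<and> set A \<subseteq> X \<and> set B \<subseteq> Y"
  using assms
proof (induction ws arbitrary: A B)
  case Nil
  then show ?case by auto
next
  case (Cons w ws)
  have hit: "\<And>w. w \<in> set ws \<Longrightarrow> X \<inter> set (fst w) \<noteq> {} \<or> Y \<inter> set (snd w) \<noteq> {}"
    using Cons.prems(10) by simp
  show ?case
  proof (cases "meets A (fst w) \<or> meets B (snd w)")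
    case True
    then have "check_hitting P n ws A B" using Cons.prems(1) by auto
    then show ?thesis by (rule Cons.IH[OF _ Cons.prems(2-9) hit])
  next
    case False
    consider a where "a \<in> X" "a \<in> set (fst w)" | b where "b \<in> Y" "b \<in> set (snd w)"
      using Cons.prems(10)[of w] by auto
    then show ?thesis
    proof cases
      case 1
      then have "a \<notin> set A" using False by (auto simp: meets_iff)
      then have "check_hitting P n ws (a # A) B"
        using Cons.prems(1) False 1 length_less_card[OF Cons.prems(2,4,6,8)]
        by (auto simp: list_all_iff split: if_splits)
      then show ?thesis
        using Cons.prems(2-9) 1(1) \<open>a \<notin> set A\<close> by (intro Cons.IH[of "a # A" B] hit) auto
    next
      case 2
      then have "b \<notin> set B" using False by (auto simp: meets_iff)
      then have "check_hitting P n ws A (b # B)"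
        using Cons.prems(1) False 2 length_less_card[OF Cons.prems(3,5,7,9)]
        by (auto simp: list_all_iff split: if_splits)
      then show ?thesis
        using Cons.prems(2-9) 2(1) \<open>b \<notin> set B\<close> by (intro Cons.IH[of A "b # B"] hit) auto
    qed
  qed
qed

lemma covers_weavesD:
  assumes "covers_weaves Ps [a, a', a''] B" "distinct [b, b', b'']" "{b, b', b''} \<subseteq> set B"
  shows "\<exists>P\<in>set Ps. P (weave a b) \<and> P (weave a' b') \<and> P (weave a'' b'')"
proof -
  have "list_all (\<lambda>b. list_all (\<lambda>b'. list_all (\<lambda>b''. distinct [b, b', b''] \<longrightarrow>
      list_ex (\<lambda>P. P (weave a'' b'')) (filter (\<lambda>P. P (weave a' b')) (filter (\<lambda>P. P (weave a b)) Ps)))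
      B) B) B"
    using assms(1) by (simp add: covers_weaves_def Let_def if_bool_eq_conj split: if_splits)
  then have "\<forall>b\<in>set B. \<forall>b'\<in>set B. \<forall>b''\<in>set B. distinct [b, b', b''] \<longrightarrow>
      list_ex (\<lambda>P. P (weave a'' b'')) (filter (\<lambda>P. P (weave a' b')) (filter (\<lambda>P. P (weave a b)) Ps))"
    unfolding list_all_iff .
  moreover have "b \<in> set B" "b' \<in> set B" "b'' \<in> set B" using assms(3) by auto
  ultimately have "list_ex (\<lambda>P. P (weave a'' b''))
      (filter (\<lambda>P. P (weave a' b')) (filter (\<lambda>P. P (weave a b)) Ps))"
    using assms(2) by metis
  then show ?thesis by (auto simp: list_ex_iff)
qed

lemma covers_weaves_lengths:
  assumes "covers_weaves Ps A B"
  obtains a a' a'' where "A = [a, a', a'']" "length B = 3"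
  using assms by (auto simp: covers_weaves_def split: list.splits if_splits)

lemma covers_pairsD:
  assumes "covers_pairs Ps xs" "x \<in> set xs" "y \<in> set xs"
  shows "\<exists>P\<in>set Ps. P x \<and> P y"
proof -
  have "covers (filter (\<lambda>P. P x) Ps) xs"
    using assms(1,2) by (simp add: covers_pairs_def list_all_iff)
  then have "list_ex (\<lambda>P. P y) (filter (\<lambda>P. P x) Ps)"
    using assms(3) by (simp add: covers_def list_all_iff)
  then show ?thesis by (auto simp: list_ex_iff)
qed

lemma occurs_cycle_imp_factor:
  assumes "v \<noteq> []" "occurs (\<lambda>i. v ! (i mod length v)) x"
  shows "x \<in> set (factors (length x) v)"
proof -
  obtain j where j: "\<And>i. i < length x \<Longrightarrow> x ! i = v ! ((j + i) mod length v)"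
    using assms(2) by (auto simp: occurs_def)
  have "x = map (\<lambda>i. v ! ((j mod length v + i) mod length v)) [0..<length x]"
    using j by (intro nth_equalityI) (auto simp: mod_add_left_eq)
  moreover have "j mod length v < length v" using assms(1) by simp
  ultimately show ?thesis unfolding factors_def by fastforce
qed

lemma playable_two:
  assumes "finite S" "card S \<le> 2" "\<And>s. s \<in> S \<Longrightarrow> length s = 5"
  shows "playable (avoiding S)"
proof -
  define Ps where "Ps = [contains_any blocks1, contains_any blocks2, contains_any blocks3, contains_any blocks4,
     misfits (pattern ''10'' ''00''), misfits (pattern ''10'' ''11'')]"
  have defeats: "defeats P" if "P \<in> set Ps" for P
    using that by (auto simp: Ps_def pattern_def bits_def
        intro!: defeats_blocks1 defeats_blocks2 defeats_blocks3 defeats_blocks4 defeats_misfits)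
  consider "S = {}" | s where "S = {s}" | s t where "S = {s, t}"
  proof -
    have "card S = 0 \<or> card S = 1 \<or> card S = 2" using assms(2) by auto
    then show thesis
      using that assms(1) by (metis card_0_eq card_1_singletonE card_2_iff)
  qed
  then obtain s t :: "bool list" where st: "S \<subseteq> {s, t}" "length s = 5" "length t = 5"
  proof cases
    case 1
    then show thesis using that[of "replicate 5 True" "replicate 5 True"] by simp
  next
    case (2 s)
    then show thesis using that[of s s] assms(3) by simp
  next
    case (3 s t)
    then show thesis using that[of s t] assms(3) by simp
  qed
  have "s \<in> set (List.n_lists 5 [False, True])" "t \<in> set (List.n_lists 5 [False, True])"
    using st by (auto simp: set_n_lists)
  then obtain P where P: "P \<in> set Ps" "P s" "P t"
    using covers_pairsD[OF covers_pairs_5] unfolding Ps_def by blast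
  then have "\<forall>s\<in>S. P s" using st(1) by auto
  then show ?thesis
    using defeats[OF P(1)] unfolding defeats_def by simp
qed

lemma playable_three:
  assumes "finite S" "card S \<le> 3" "\<And>s. s \<in> S \<Longrightarrow> length s = 9"
  shows "playable (avoiding S)"
proof (rule ccontr)
  assume nplay: "\<not> playable (avoiding S)"
  define Ps where "Ps = [contains_any blocks1, contains_any blocks3, contains_any blocks4, contains_any blocks2,
     misfits (pattern ''11001100'' ''01011010'')]"
  have defeats: "defeats P" if "P \<in> set Ps" for P
    using that by (auto simp: Ps_def pattern_def bits_def
        intro!: defeats_blocks1 defeats_blocks2 defeats_blocks3 defeats_blocks4 defeats_misfits)
  define vs where "vs = map bits
       [''0'', ''1'', ''01'', ''011'', ''001'', ''0111'', ''0001'', ''00011'', ''00111'']"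
  \<comment> \<open>If no half occurred in the word of period \<open>v\<close>,
    \<open>playable_half_control\<close> would apply.\<close>
  have hit: "evens ` S \<inter> set (factors 5 v) \<noteq> {} \<or> odds ` S \<inter> set (factors 4 v) \<noteq> {}"
    if "v \<in> set vs" for v
  proof -
    have "v \<noteq> []" using that by (auto simp: vs_def bits_def)
    obtain s where s: "s \<in> S" "occurs (\<lambda>i. v ! (i mod length v)) (evens s) \<or>
        occurs (\<lambda>i. v ! (i mod length v)) (odds s)"
      using playable_half_control[of S "\<lambda>i. v ! (i mod length v)"] nplay by blast
    have "length (evens s) = 5" "length (odds s) = 4"
      using assms(3)[OF s(1)] by (simp_all add: length_evens length_odds)
    then show ?thesis
      using s occurs_cycle_imp_factor[OF \<open>v \<noteq> []\<close>, of "evens s"]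
        occurs_cycle_imp_factor[OF \<open>v \<noteq> []\<close>, of "odds s"] by auto
  qed
  have "\<exists>A B. covers_weaves Ps A B \<and> distinct A \<and> distinct B \<and> set A \<subseteq> evens ` S \<and> set B \<subseteq> odds ` S"
  proof (rule check_hitting_sound)
    show "check_hitting (covers_weaves Ps) 3 (map (\<lambda>v. (factors 5 v, factors 4 v)) vs) [] []"
      using check_hitting_9 unfolding Ps_def vs_def .
    show "card (evens ` S) \<le> 3" "card (odds ` S) \<le> 3"
      using assms(1,2) card_image_le le_trans by blast+
  qed (use assms(1) hit in auto)
  then obtain A B where AB: "covers_weaves Ps A B" "distinct A" "distinct B"
      "set A \<subseteq> evens ` S" "set B \<subseteq> odds ` S" by auto
  obtain a a' a'' where A: "A = [a, a', a'']" and "length B = 3"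
    using covers_weaves_lengths[OF AB(1)] .
  obtain s s' s'' where s: "s \<in> S" "s' \<in> S" "s'' \<in> S" "a = evens s" "a' = evens s'" "a'' = evens s''"
    using AB(4) A by auto
  \<comment> \<open>Distinct even halves come from distinct strings, so these three exhaust
    \<open>S\<close>.\<close>
  then have "s \<noteq> s'" "s \<noteq> s''" "s' \<noteq> s''"
    using AB(2) A by auto
  then have "card {s, s', s''} = 3"
    by simp
  then have S: "S = {s, s', s''}"
    using assms(1,2) s card_seteq[of S "{s, s', s''}"] by auto
  \<comment> \<open>\<open>B\<close> has three elements among the odd halves of three strings, so
    these are distinct and lie in \<open>B\<close>: the true matching was tested.\<close>
  have "card (set B) = 3" using AB(3) \<open>length B = 3\<close> by (simp add: distinct_card)
  moreover have "set B \<subseteq> set [odds s, odds s', odds s'']" using AB(5) S by auto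
  ultimately have dist: "distinct [odds s, odds s', odds s'']"
    and B: "{odds s, odds s', odds s''} \<subseteq> set B"
    using card_mono[of "set [odds s, odds s', odds s'']" "set B"]
      card_seteq[of "set [odds s, odds s', odds s'']" "set B"]
      card_length[of "[odds s, odds s', odds s'']"]
      card_distinct[of "[odds s, odds s', odds s'']"]
    by auto
  obtain P where "P \<in> set Ps" "P s" "P s'" "P s''"
    using covers_weavesD[OF AB(1)[unfolded A] dist B] s(4-6) by (auto simp: weave_evens_odds)
  then have "defeats P" "\<forall>s\<in>S. P s"
    using defeats S by auto
  then show False
    using nplay unfolding defeats_def by simp
qed

section \<open>At least four strings\<close>

lemma sum_shift_cyclic:
  fixes g :: "nat \<Rightarrow> nat"
  shows "(\<Sum>i<m. g ((j + i) mod m)) = (\<Sum>i<m. g (i mod m))"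
proof (induction j)
  case 0
  then show ?case by simp
next
  case (Suc j)
  define f where "f = (\<lambda>i. g ((j + i) mod m))"
  have "f 0 + (\<Sum>i<m. f (Suc i)) = (\<Sum>i<m. f i) + f m"
    using sum.lessThan_Suc_shift[of f m] by simp
  moreover have "f m = f 0" by (simp add: f_def)
  ultimately show ?case using Suc by (simp add: f_def)
qed

definition ones :: "nat \<Rightarrow> (nat \<Rightarrow> bool) \<Rightarrow> nat" where
  "ones m w = card {i. i < m \<and> w i}"

text \<open>The number of cyclic occurrences of 10, which is the number of runs of ones around the
  circle when the word is not constant.\<close>

definition drops :: "nat \<Rightarrow> (nat \<Rightarrow> bool) \<Rightarrow> nat" where
  "drops m w = card {i. i < m \<and> w i \<and> \<not> w (Suc i mod m)}"

lemma card_cyclic: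
  fixes P :: "nat \<Rightarrow> bool"
  shows "card {i. i < m \<and> P i} = (\<Sum>i<m. of_bool (P ((j + i) mod m)))"
proof -
  have "(\<Sum>i<m. of_bool (P ((j + i) mod m))) = (\<Sum>i<m. of_bool (P (i mod m)) :: nat)"
    by (rule sum_shift_cyclic[of "\<lambda>x. of_bool (P x)"])
  also have "\<dots> = (\<Sum>i<m. of_bool (P i))" by simp
  also have "\<dots> = card {i. i < m \<and> P i}"
    by (simp add: sum_of_bool_eq Int_def lessThan_def)
  finally show ?thesis by simp
qed

text \<open>\<open>x\<close> shows a whole period of both words, so they are rotations of each
  other, and both counts ignore the starting point.\<close>

lemma cyclic_word_invariants:
  assumes "m > 0" "occurs (\<lambda>i. w (i mod m)) x" "occurs (\<lambda>i. w' (i mod m)) x" "length x \<ge> m"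
  shows "ones m w = ones m w'" "drops m w = drops m w'"
proof -
  obtain j j' where "\<And>i. i < length x \<Longrightarrow> x ! i = w ((j + i) mod m)"
    "\<And>i. i < length x \<Longrightarrow> x ! i = w' ((j' + i) mod m)"
    using assms(2,3) unfolding occurs_def by blast
  then have "w ((j + i mod m) mod m) = w' ((j' + i mod m) mod m)" for i
    using assms(1,4) by (metis mod_less_divisor order_less_le_trans)
  then have eq: "w ((j + i) mod m) = w' ((j' + i) mod m)" for i
    by (simp add: mod_add_right_eq)
  show "ones m w = ones m w'"
    unfolding ones_def card_cyclic[of m w j] card_cyclic[of m w' j'] by (simp add: eq)
  show "drops m w = drops m w'"
    unfolding drops_def card_cyclic[of m "\<lambda>i. w i \<and> \<not> w (Suc i mod m)" j]
      card_cyclic[of m "\<lambda>i. w' i \<and> \<not> w' (Suc i mod m)" j']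
    using eq eq[of "Suc _"] by (simp add: mod_Suc_eq)
qed

text \<open>Indices up to \<open>m\<close> give a single block of \<open>a\<close> ones;
  \<open>m + 1\<close> and \<open>m + 2\<close> give 1010...0 and its complement.\<close>

definition cyclic_word :: "nat \<Rightarrow> nat \<Rightarrow> nat \<Rightarrow> bool" where
  "cyclic_word m a i \<longleftrightarrow> (if a \<le> m then i < a else if a = m + 1 then i \<in> {0, 2} else i \<notin> {0, 2})"

lemma ones_cyclic_word:
  assumes "m \<ge> 6"
  shows "a \<le> m \<Longrightarrow> ones m (cyclic_word m a) = a"
    and "ones m (cyclic_word m (m + 1)) = 2"
    and "ones m (cyclic_word m (m + 2)) = m - 2"
proof -
  show "ones m (cyclic_word m a) = a" if "a \<le> m"
  proof -
    have "{i. i < m \<and> cyclic_word m a i} = {..<a}" using that by (auto simp: cyclic_word_def)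
    then show ?thesis by (simp add: ones_def)
  qed
  have "{i. i < m \<and> cyclic_word m (m + 1) i} = {0, 2}" using assms by (auto simp: cyclic_word_def)
  then show "ones m (cyclic_word m (m + 1)) = 2" by (simp add: ones_def)
  have "{i. i < m \<and> cyclic_word m (m + 2) i} = {..<m} - {0, 2}" using assms by (auto simp: cyclic_word_def)
  moreover have "card ({..<m} - {0, 2}) = m - 2"
    using assms by (subst card_Diff_subset) auto
  ultimately show "ones m (cyclic_word m (m + 2)) = m - 2" by (simp add: ones_def)
qed

lemma drops_cyclic_word:
  assumes "m \<ge> 6"
  shows "a \<le> m \<Longrightarrow> drops m (cyclic_word m a) \<le> 1"
    and "m < a \<Longrightarrow> drops m (cyclic_word m a) \<ge> 2"
proof -
  show "drops m (cyclic_word m a) \<le> 1" if "a \<le> m"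
  proof -
    have "{i. i < m \<and> cyclic_word m a i \<and> \<not> cyclic_word m a (Suc i mod m)} \<subseteq> {a - 1}"
    proof
      fix i assume "i \<in> {i. i < m \<and> cyclic_word m a i \<and> \<not> cyclic_word m a (Suc i mod m)}"
      then have i: "i < m" "i < a" "\<not> Suc i mod m < a" using that by (auto simp: cyclic_word_def)
      then have "Suc i \<noteq> m" by auto
      then have "Suc i mod m = Suc i" using i(1) by simp
      then show "i \<in> {a - 1}" using i by auto
    qed
    then show ?thesis
      unfolding drops_def using card_mono[of "{a - 1}"] by simp
  qed
  show "drops m (cyclic_word m a) \<ge> 2" if "m < a"
  proof -
    define D where "D = {i. i < m \<and> cyclic_word m a i \<and> \<not> cyclic_word m a (Suc i mod m)}"
    have "finite D" by (simp add: D_def)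
    have "\<exists>E\<subseteq>D. card E = 2"
    proof (cases "a = m + 1")
      case True
      then have "{0, 2} \<subseteq> D" using assms by (auto simp: D_def cyclic_word_def)
      then show ?thesis by (intro exI[of _ "{0, 2}"]) simp
    next
      case False
      \<comment> \<open>The zeros are at 0 and 2: one drop leads from 1 to 2, the other from
        \<open>m - 1\<close> around to 0.\<close>
      then have "{1, m - 1} \<subseteq> D" using assms that by (auto simp: D_def cyclic_word_def)
      then show ?thesis using assms by (intro exI[of _ "{1, m - 1}"]) auto
    qed
    then obtain E where "E \<subseteq> D" "card E = 2" by blast
    then have "2 \<le> card D" using card_mono[OF \<open>finite D\<close>] by metis
    then show ?thesis by (simp add: drops_def D_def)
  qed
qed

text \<open>\<open>drops\<close> separates the single blocks from the last two words; within each
  kind \<open>ones\<close> decides, as 2 and \<open>m - 2\<close> differ.\<close>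

lemma cyclic_word_inj:
  assumes "m \<ge> 6" "a \<le> m + 2" "b \<le> m + 2"
    and "ones m (cyclic_word m a) = ones m (cyclic_word m b)"
    and "drops m (cyclic_word m a) = drops m (cyclic_word m b)"
  shows "a = b"
proof (cases "a \<le> m")
  case True
  then have "b \<le> m"
    using drops_cyclic_word[OF assms(1)] assms(5) by (metis leI not_less_eq_eq numeral_2_eq_2 One_nat_def)
  then show ?thesis using True assms(1,4) by (simp add: ones_cyclic_word)
next
  case False
  then have "\<not> b \<le> m"
    using drops_cyclic_word[OF assms(1)] assms(5) by (metis leI not_less_eq_eq numeral_2_eq_2 One_nat_def)
  then have "a = m + 1 \<or> a = m + 2" "b = m + 1 \<or> b = m + 2" using False assms(2,3) by auto
  then show ?thesis using assms(1,4) ones_cyclic_word(2,3)[OF assms(1)] by auto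
qed

lemma playable_many:
  assumes "finite S" "card S \<le> k" "k \<ge> 4" "\<And>s. s \<in> S \<Longrightarrow> length s = 4 * k - 3"
  shows "playable (avoiding S)"
proof (rule ccontr)
  assume nplay: "\<not> playable (avoiding S)"
  define m where "m = 2 * k - 2"
  have m: "m \<ge> 6" using assms(3) by (simp add: m_def)
  define X where "X = evens ` S \<union> odds ` S"
  have "\<exists>x\<in>X. occurs (\<lambda>i. cyclic_word m a (i mod m)) x" for a
    using playable_half_control[of S "\<lambda>i. cyclic_word m a (i mod m)"] nplay
    unfolding X_def by blast
  then obtain f where f: "\<And>a. f a \<in> X" "\<And>a. occurs (\<lambda>i. cyclic_word m a (i mod m)) (f a)"
    by metis
  \<comment> \<open>The odd half is the shorter one, of length
    \<open>(4 * k - 3) div 2 = m\<close>.\<close>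
  have len: "length x \<ge> m" if "x \<in> X" for x
    using that assms(3,4) by (auto simp: X_def m_def length_evens length_odds)
  have "inj_on f {..m + 2}"
  proof (rule inj_onI)
    fix a b assume "a \<in> {..m + 2}" "b \<in> {..m + 2}" "f a = f b"
    then show "a = b"
      using cyclic_word_invariants[of m "cyclic_word m a" "f a" "cyclic_word m b"] f(2)[of a] f(2)[of b]
        len[OF f(1)[of a]] m cyclic_word_inj[OF m] by simp
  qed
  moreover have "finite X" using assms(1) by (simp add: X_def)
  moreover have "f ` {..m + 2} \<subseteq> X" using f(1) by blast
  ultimately have "card {..m + 2} \<le> card X" by (intro card_inj_on_le)
  then have "m + 3 \<le> card X" by simp
  also have "card X \<le> card S + card S"
    unfolding X_def using card_Un_le card_image_le[OF assms(1)] by (meson add_mono le_trans)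
  finally show False using assms(2,3) by (simp add: m_def)
qed

section \<open>The bound\<close>

text \<open>A word containing a string contains its prefixes, so truncation only restricts the
  Obscurer.\<close>

lemma avoiding_take: "avoiding (take n ` S) \<subseteq> avoiding S"
proof
  fix w assume w: "w \<in> avoiding (take n ` S)"
  have "\<not> sublist s w" if "s \<in> S" for s
  proof
    assume "sublist s w"
    then have "sublist (take n s) w" by (rule sublist_order.order.trans[OF sublist_take])
    then show False using w that by (auto simp: avoiding_def)
  qed
  then show "w \<in> avoiding S" by (simp add: avoiding_def)
qed

theorem theorem10:
  fixes S :: "bool list set" and k :: nat
  assumes "finite S" and "card S = k" and "k \<ge> 2"
    and "[] \<notin> S"
    and "seeker_wins (avoiding S)"
  shows "Min (length ` S) \<le> 4 * k - 4"
proof (rule ccontr)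
  assume *: "\<not> Min (length ` S) \<le> 4 * k - 4"
  have "S \<noteq> {}" using assms(2,3) by auto
  \<comment> \<open>All strings are cut to the least length above the bound. Some may coincide
    afterwards, so only \<open>card T \<le> k\<close> is available.\<close>
  define T where "T = take (4 * k - 3) ` S"
  have len: "length s = 4 * k - 3" if "s \<in> T" for s
  proof -
    obtain t where t: "t \<in> S" "s = take (4 * k - 3) t" using \<open>s \<in> T\<close> by (auto simp: T_def)
    then have "Min (length ` S) \<le> length t" using assms(1) by simp
    then show ?thesis using * t(2) by simp
  qed
  have T: "finite T" "card T \<le> k"
    using assms(1,2) card_image_le[OF assms(1)] by (auto simp: T_def)
  consider "k = 2" | "k = 3" | "k \<ge> 4" using assms(3) by linarith
  then have "playable (avoiding T)"
  proof cases
    case 1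
    then show ?thesis using playable_two T len by simp
  next
    case 2
    then show ?thesis using playable_three T len by simp
  next
    case 3
    then show ?thesis using playable_many T len by blast
  qed
  then have "playable (avoiding S)"
    unfolding T_def by (rule playable_mono[OF _ avoiding_take])
  then show False using playable_not_seeker_wins assms(5) by blast
qed

end
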